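(* Let $\{X_{n,i};i=1,\dots,k_n\}$, $n\ge1$, be an array of (row-wise) independent random variables in a sub-linear expectation space $(\Omega,\mathscr H,\widehat{\mathbb E})$ with $s_n^2=\sum_{i=1}^{k_n}\widehat{\mathbb E}[X_{n,i}^2]$, and let $\mathbb V$ be a sub-additive capacity on $\mathcal F$ satisfying the compatibility property (C). Let $\{x_n\}$ be a sequence of positive numbers with $x_n\to\infty$ and $x_n/s_n\to0$. Suppose $$\frac{\sum_{i=1}^{k_n}|\widehat{\mathbb E}[X_{n,i}]|}{s_nx_n}\to0,\qquad\frac{\sum_{i=1}^{k_n}|\widehat{\mathcal E}[X_{n,i}]|}{s_nx_n}\to0,$$ and there exists a positive number $\alpha$ such that $$|X_{n,i}|\le\alpha\frac{s_n}{x_n},\qquad i=1,\dots,k_n.$$ Then for any $\gamma>0$ there exists a (small enough) positive constant $\pi(\gamma)$ such that $$\liminf_{n\to\infty}x_n^{-2}\ln\mathbb V\Big(\sum_{i=1}^{k_n}X_{n,i}\ge zs_nx_n\Big)\ge-\frac{z^2}2(1+\gamma)\quad\text{for all }z\text{ with }0<z\alpha\le\pi(\gamma).$$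
   Context: Sub-linear expectation space: $(\Omega,\mathcal F)$ is a measurable space and $\mathscr H$ is a linear space of real measurable functions on it such that $\varphi(X_1,\dots,X_n)\in\mathscr H$ whenever $X_1,\dots,X_n\in\mathscr H$ and $\varphi\in C_{l,Lip}(\mathbb R^n)$, where $C_{l,Lip}(\mathbb R^n)$ is the set of $\varphi$ with $|\varphi(x)-\varphi(y)|\le C(1+|x|^m+|y|^m)|x-y|$ for some $C>0$, $m\in\mathbb N$ depending on $\varphi$. A sub-linear expectation is a map $\widehat{\mathbb E}:\mathscr H\to[-\infty,\infty]$ such that: $X\ge Y$ implies $\widehat{\mathbb E}[X]\ge\widehat{\mathbb E}[Y]$; $\widehat{\mathbb E}[c]=c$ for constants $c$; $\widehat{\mathbb E}[X+Y]\le\widehat{\mathbb E}[X]+\widehat{\mathbb E}[Y]$ whenever the right side is not of the form $\infty-\infty$; $\widehat{\mathbb E}[\lambda X]=\lambda\widehat{\mathbb E}[X]$ for $\lambda\ge0$ (with $0\cdot\infty=0$). The conjugate expectation is $\widehat{\mathcal E}[X]=-\widehat{\mathbb E}[-X]$. Elements of $\mathscr H$ are called random variables. Independence: a random vector $\bm Y\in\mathscr H^n$ is independent to $\bm X\in\mathscr H^m$ if $\widehat{\mathbb E}[\varphi(\bm X,\bm Y)]=\widehat{\mathbb E}\big[\widehat{\mathbb E}[\varphi(\bm x,\bm Y)]|_{\bm x=\bm X}\big]$ for each $\varphi\in C_{l,Lip}(\mathbb R^m\times\mathbb R^n)$ with $\overline\varphi(\bm x):=\widehat{\mathbb E}[|\varphi(\bm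 x,\bm Y)|]<\infty$ for all $\bm x$ and $\widehat{\mathbb E}[|\overline\varphi(\bm X)|]<\infty$. Random variables $X_1,\dots,X_k$ are independent if $X_{i+1}$ is independent to $(X_1,\dots,X_i)$ for each $1\le i<k$. Capacities: a capacity is a monotone set function $V:\mathcal F\to[0,1]$ with $V(\emptyset)=0$, $V(\Omega)=1$; it is sub-additive if $V(A\cup B)\le V(A)+V(B)$. Property (C) for $\mathbb V$: $\widehat{\mathbb E}[f]\le\mathbb V(A)\le\widehat{\mathbb E}[g]$ whenever $f\le I_A\le g$, $f,g\in\mathscr H$, $A\in\mathcal F$. *)

theory Defs
  imports "HOL-Analysis.Analysis"
begin

text \<open>
  Vectors in \<open>\<real>\<^sup>n\<close> are functions \<^typ>\<open>nat \<Rightarrow> real\<close> of which only the coordinates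
  \<open>1, \<dots>, n\<close> are relevant.  The condition below is imposed on all such functions, so it forces
  \<open>\<phi>\<close> to depend on these coordinates only: if \<open>u\<close> and \<open>v\<close> agree on them, the right-hand
  side is \<open>0\<close>.
\<close>
definition C_l_Lip :: "nat \<Rightarrow> ((nat \<Rightarrow> real) \<Rightarrow> real) set" where
  "C_l_Lip n = {\<phi>. \<exists>C>0. \<exists>m::nat. \<forall>u v.
     \<bar>\<phi> u - \<phi> v\<bar> \<le> C * (1 + L2_set u {1..n} ^ m + L2_set v {1..n} ^ m) * L2_set (\<lambda>i. u i - v i) {1..n}}"

definition append_vec :: "nat \<Rightarrow> (nat \<Rightarrow> real) \<Rightarrow> (nat \<Rightarrow> real) \<Rightarrow> nat \<Rightarrow> real" where
  "append_vec m u v = (\<lambda>i. if i \<le> m then u i else v (i - m))"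

text \<open>
  Only \<^term>\<open>space M\<close> and \<^term>\<open>sets M\<close> are used; they form the measurable space
  \<open>(\<Omega>, \<F>)\<close>, and the measure carried by \<open>M\<close> plays no role.  The values of \<open>E\<close> outside
  \<open>H\<close> are irrelevant.
\<close>
locale sublinear_expectation_space =
  fixes M :: "'a measure"
    and H :: "('a \<Rightarrow> real) set"
    and E :: "('a \<Rightarrow> real) \<Rightarrow> ereal"
  assumes H_measurable: "H \<subseteq> borel_measurable M"
    and H_zero: "(\<lambda>\<omega>. 0) \<in> H"
    and H_add: "X \<in> H \<Longrightarrow> Y \<in> H \<Longrightarrow> (\<lambda>\<omega>. X \<omega> + Y \<omega>) \<in> H"
    and H_scale: "X \<in> H \<Longrightarrow> (\<lambda>\<omega>. c * X \<omega>) \<in> H"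
    and H_comp: "n \<ge> 1 \<Longrightarrow> (\<And>i. i \<in> {1..n} \<Longrightarrow> Z i \<in> H) \<Longrightarrow> \<phi> \<in> C_l_Lip n \<Longrightarrow>
      (\<lambda>\<omega>. \<phi> (\<lambda>i. Z i \<omega>)) \<in> H"
    and E_mono: "X \<in> H \<Longrightarrow> Y \<in> H \<Longrightarrow> (\<And>\<omega>. \<omega> \<in> space M \<Longrightarrow> X \<omega> \<ge> Y \<omega>) \<Longrightarrow> E X \<ge> E Y"
    and E_const: "E (\<lambda>\<omega>. c) = ereal c"
    and E_subadd: "X \<in> H \<Longrightarrow> Y \<in> H \<Longrightarrow>
      \<not> (E X = \<infinity> \<and> E Y = -\<infinity>) \<Longrightarrow> \<not> (E X = -\<infinity> \<and> E Y = \<infinity>) \<Longrightarrow>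
      E (\<lambda>\<omega>. X \<omega> + Y \<omega>) \<le> E X + E Y"
    and E_scale: "X \<in> H \<Longrightarrow> c \<ge> 0 \<Longrightarrow> E (\<lambda>\<omega>. c * X \<omega>) = ereal c * E X"

definition conj_expectation :: "(('a \<Rightarrow> real) \<Rightarrow> ereal) \<Rightarrow> ('a \<Rightarrow> real) \<Rightarrow> ereal" where
  "conj_expectation E X = - E (\<lambda>\<omega>. - X \<omega>)"

text \<open>
  \<open>Y\<close> (with components \<open>1, \<dots>, n\<close>) is independent to \<open>X\<close> (with components
  \<open>1, \<dots>, m\<close>).  Since \<open>\<phi>bar u < \<infinity>\<close> for all \<open>u\<close>, both \<open>\<phi>bar u\<close> and \<open>E[\<phi>(u, Y)]\<close> are finite,
  so \<^const>\<open>real_of_ereal\<close> loses nothing.  The membership conditions say that the two random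
  variables to which the outer \<open>E\<close> is applied belong to its domain; the written formula
  presupposes this.
\<close>
definition independent_to ::
  "('a \<Rightarrow> real) set \<Rightarrow> (('a \<Rightarrow> real) \<Rightarrow> ereal) \<Rightarrow> nat \<Rightarrow> (nat \<Rightarrow> 'a \<Rightarrow> real) \<Rightarrow> nat \<Rightarrow> (nat \<Rightarrow> 'a \<Rightarrow> real) \<Rightarrow> bool"
where
  "independent_to H E n Y m X \<longleftrightarrow>
    (\<forall>\<phi> \<in> C_l_Lip (m + n).
      let \<phi>bar = (\<lambda>u. E (\<lambda>\<omega>. \<bar>\<phi> (append_vec m u (\<lambda>j. Y j \<omega>))\<bar>));
          \<phi>bar_X = (\<lambda>\<omega>. \<bar>real_of_ereal (\<phi>bar (\<lambda>i. X i \<omega>))\<bar>);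
          \<psi> = (\<lambda>u. E (\<lambda>\<omega>. \<phi> (append_vec m u (\<lambda>j. Y j \<omega>))));
          \<psi>_X = (\<lambda>\<omega>. real_of_ereal (\<psi> (\<lambda>i. X i \<omega>)))
      in (\<forall>u. \<phi>bar u < \<infinity>) \<longrightarrow> \<phi>bar_X \<in> H \<longrightarrow> E \<phi>bar_X < \<infinity> \<longrightarrow> \<psi>_X \<in> H \<longrightarrow>
        E (\<lambda>\<omega>. \<phi> (append_vec m (\<lambda>i. X i \<omega>) (\<lambda>j. Y j \<omega>))) = E \<psi>_X)"

definition independent_rvs ::
  "('a \<Rightarrow> real) set \<Rightarrow> (('a \<Rightarrow> real) \<Rightarrow> ereal) \<Rightarrow> nat \<Rightarrow> (nat \<Rightarrow> 'a \<Rightarrow> real) \<Rightarrow> bool" where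
  "independent_rvs H E k X \<longleftrightarrow>
    (\<forall>i. 1 \<le> i \<and> i < k \<longrightarrow> independent_to H E 1 (\<lambda>_. X (i + 1)) i X)"

definition capacity :: "'a measure \<Rightarrow> ('a set \<Rightarrow> real) \<Rightarrow> bool" where
  "capacity M V \<longleftrightarrow>
    (\<forall>A\<in>sets M. 0 \<le> V A \<and> V A \<le> 1) \<and>
    (\<forall>A\<in>sets M. \<forall>B\<in>sets M. A \<subseteq> B \<longrightarrow> V A \<le> V B) \<and>
    V {} = 0 \<and> V (space M) = 1"

definition subadditive_capacity :: "'a measure \<Rightarrow> ('a set \<Rightarrow> real) \<Rightarrow> bool" where
  "subadditive_capacity M V \<longleftrightarrow>
    capacity M V \<and> (\<forall>A\<in>sets M. \<forall>B\<in>sets M. V (A \<union> B) \<le> V A + V B)"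

definition property_C ::
  "'a measure \<Rightarrow> ('a \<Rightarrow> real) set \<Rightarrow> (('a \<Rightarrow> real) \<Rightarrow> ereal) \<Rightarrow> ('a set \<Rightarrow> real) \<Rightarrow> bool" where
  "property_C M H E V \<longleftrightarrow>
    (\<forall>A\<in>sets M. \<forall>f\<in>H. \<forall>g\<in>H.
      (\<forall>\<omega>\<in>space M. f \<omega> \<le> indicator A \<omega> \<and> indicator A \<omega> \<le> g \<omega>) \<longrightarrow>
      E f \<le> ereal (V A) \<and> ereal (V A) \<le> E g)"

text \<open>
  The logarithm with \<open>ln 0 = -\<infinity>\<close>; \<^const>\<open>ln\<close> on the reals has \<open>ln 0 = 0\<close>.
\<close>
definition ln_ext :: "real \<Rightarrow> ereal" where
  "ln_ext p = (if p > 0 then ereal (ln p) else -\<infinity>)"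

end

theory Submission
  imports Defs
begin

text \<open>
  By independence, the exponential moment of \<open>S\<^sub>n = \<Sum>i. X\<^sub>n\<^sub>i\<close> is exactly the product of those of the
  \<open>X\<^sub>n\<^sub>i\<close>.  A second-order expansion therefore gives \<open>E (exp (c x\<^sup>2 W)) \<approx> exp (c\<^sup>2 x\<^sup>2 / 2)\<close> for
  \<open>W = S\<^sub>n / (s\<^sub>n x\<^sub>n)\<close>, up to a relative error in the exponent that is small with \<open>c \<alpha>\<close>.  With
  \<open>z < l < b\<close> close together and tilt \<open>l\<close>, the part of \<open>exp (l x\<^sup>2 W)\<close> from \<open>W < z\<close> is dominated by the
  tilt \<open>z\<close> and the part from \<open>W > b\<close> by the tilt \<open>b\<close>; both are exponentially negligible.  Since
  \<open>exp (l x\<^sup>2 W) \<le> exp (l b x\<^sup>2)\<close> when \<open>W \<le> b\<close>, subtracting the dominating exponentials and dividing by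
  \<open>exp (l b x\<^sup>2)\<close> gives an element of \<open>H\<close> below the indicator of \<open>W \<ge> z\<close>, to which property (C) applies.
\<close>

section \<open>Membership in the test class \<open>C_l_Lip\<close>\<close>

lemma C_l_Lip_const: "(\<lambda>u. c) \<in> C_l_Lip n"
  unfolding C_l_Lip_def
  by (auto intro!: exI[of _ "1::real"] mult_nonneg_nonneg add_nonneg_nonneg L2_set_nonneg)

lemma C_l_Lip_square: "(\<lambda>u. (u 1)\<^sup>2) \<in> C_l_Lip 1"
proof -
  have "\<bar>(u 1)\<^sup>2 - (v 1)\<^sup>2\<bar> \<le> 1 * (1 + L2_set u {1..1} ^ 1 + L2_set v {1..1} ^ 1)
      * L2_set (\<lambda>i. u i - v i) {1..1}" for u v :: "nat \<Rightarrow> real"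
  proof -
    have "\<bar>(u 1)\<^sup>2 - (v 1)\<^sup>2\<bar> = \<bar>u 1 + v 1\<bar> * \<bar>u 1 - v 1\<bar>"
      by (simp add: power2_eq_square square_diff_square_factored abs_mult)
    also have "\<dots> \<le> (1 + \<bar>u 1\<bar> + \<bar>v 1\<bar>) * \<bar>u 1 - v 1\<bar>"
      by (intro mult_right_mono) auto
    finally show ?thesis by (simp add: L2_set_def)
  qed
  then show ?thesis
    unfolding C_l_Lip_def mem_Collect_eq
    by (intro exI[of _ "1::real"] conjI exI[of _ "1::nat"] allI) auto
qed

text \<open>The exponential grows too fast to be a test function, so independence is applied to
  products of a bounded Lipschitz \<open>g\<close>. Changing one coordinate at a time bounds the
  difference of two such products, and growth exponent \<open>0\<close> suffices.\<close>

lemma C_l_Lip_prod: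
  fixes g :: "real \<Rightarrow> real"
  assumes bnd: "\<And>a. \<bar>g a\<bar> \<le> K" and lip: "\<And>a b. \<bar>g a - g b\<bar> \<le> L * \<bar>a - b\<bar>"
  shows "(\<lambda>u. \<Prod>i=1..n. g (u i)) \<in> C_l_Lip n"
proof -
  \<comment> \<open>Raising both constants to at least 1 makes the powers of \<open>K'\<close>
    increasing and keeps every factor nonnegative.\<close>
  define K' where "K' = max 1 K"
  define L' where "L' = max 1 L"
  have K': "K' \<ge> 1" "\<bar>g a\<bar> \<le> K'" for a
    using bnd[of a] by (auto simp: K'_def)
  have L': "L' \<ge> 1" "\<bar>g a - g b\<bar> \<le> L' * \<bar>a - b\<bar>" for a b
    using lip[of a b] mult_right_mono[of L L' "\<bar>a - b\<bar>"] by (auto simp: L'_def)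
  have prod_bnd: "\<bar>\<Prod>i=1..j. g (u i)\<bar> \<le> K' ^ j" for j u
    using K' by (induction j) (auto simp: abs_mult mult_ac intro!: mult_mono)
  have diff: "\<bar>(\<Prod>i=1..j. g (u i)) - (\<Prod>i=1..j. g (v i))\<bar>
      \<le> L' * K' ^ j * (\<Sum>i=1..j. \<bar>u i - v i\<bar>)" for j u v
  proof (induction j)
    case (Suc j)
    define P where "P = (\<Prod>i=1..j. g (u i))"
    define Q where "Q = (\<Prod>i=1..j. g (v i))"
    define D where "D = (\<Sum>i=1..j. \<bar>u i - v i\<bar>)"
    define a where "a = u (Suc j)"
    define b where "b = v (Suc j)"
    \<comment> \<open>Telescoping: exchange the last factor first, then the product of the first
      \<open>j\<close>.\<close>
    have "\<bar>P * g a - Q * g b\<bar> = \<bar>P * (g a - g b) + (P - Q) * g b\<bar>"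
      by (simp add: algebra_simps)
    also have "\<dots> \<le> \<bar>P\<bar> * \<bar>g a - g b\<bar> + \<bar>P - Q\<bar> * \<bar>g b\<bar>"
      by (metis abs_mult abs_triangle_ineq)
    also have "\<dots> \<le> K' ^ Suc j * (L' * \<bar>a - b\<bar>) + (L' * K' ^ j * D) * K'"
    proof (intro add_mono mult_mono)
      have "\<bar>P\<bar> \<le> K' ^ j" unfolding P_def by (rule prod_bnd)
      also have "\<dots> \<le> K' ^ Suc j" using K'(1) by (intro power_increasing) auto
      finally show "\<bar>P\<bar> \<le> K' ^ Suc j" .
    qed (use Suc.IH K' L' in \<open>auto simp: P_def Q_def D_def intro!: mult_nonneg_nonneg sum_nonneg\<close>)
    also have "\<dots> = L' * K' ^ Suc j * (D + \<bar>a - b\<bar>)"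
      by (simp add: algebra_simps)
    finally show ?case by (simp add: P_def Q_def D_def a_def b_def)
  qed simp
  \<comment> \<open>With growth exponent \<open>0\<close> the growth factor in the definition is 3.
    The summand 1 keeps \<open>C\<close> positive also for \<open>n = 0\<close>.\<close>
  define C where "C = L' * K' ^ n * (real n + 1)"
  have "C > 0" using K' L'(1) unfolding C_def
    by (intro mult_pos_pos zero_less_power) auto
  moreover have "\<bar>(\<Prod>i=1..n. g (u i)) - (\<Prod>i=1..n. g (v i))\<bar>
      \<le> C * (1 + L2_set u {1..n} ^ 0 + L2_set v {1..n} ^ 0) * L2_set (\<lambda>i. u i - v i) {1..n}" for u v
  proof -
    let ?l = "L2_set (\<lambda>i. u i - v i) {1..n}"
    have "\<bar>u i - v i\<bar> \<le> ?l" if "i \<in> {1..n}" for i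
    proof -
      have "\<bar>u i - v i\<bar> \<le> L2_set (\<lambda>i. \<bar>u i - v i\<bar>) {1..n}"
        by (rule member_le_L2_set) (use that in auto)
      then show ?thesis by (simp add: L2_set_def)
    qed
    then have "(\<Sum>i=1..n. \<bar>u i - v i\<bar>) \<le> real n * ?l"
      using sum_bounded_above[of "{1..n}" "\<lambda>i. \<bar>u i - v i\<bar>" ?l] by simp
    also have "\<dots> \<le> (real n + 1) * 3 * ?l"
      by (intro mult_right_mono L2_set_nonneg) auto
    finally have "L' * K' ^ n * (\<Sum>i=1..n. \<bar>u i - v i\<bar>) \<le> L' * K' ^ n * ((real n + 1) * 3 * ?l)"
      using K'(1) L'(1) by (intro mult_left_mono) auto
    from order_trans[OF diff this] show ?thesis by (simp add: C_def algebra_simps)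
  qed
  ultimately show ?thesis unfolding C_l_Lip_def by blast
qed

section \<open>Elementary bounds for the exponential and the algebra of the tilts\<close>

lemma exp_Lipschitz_below:
  fixes a b c :: real
  assumes "a \<le> c" "b \<le> c"
  shows "\<bar>exp a - exp b\<bar> \<le> exp c * \<bar>a - b\<bar>"
proof -
  have "exp y - exp x \<le> exp c * (y - x)" if "x \<le> y" "y \<le> c" for x y :: real
  proof -
    \<comment> \<open>The tangent of the exponential at \<open>y\<close> lies below its graph at
      \<open>x\<close>.\<close>
    have "exp y * (1 + (x - y)) \<le> exp y * exp (x - y)"
      by (intro mult_left_mono exp_ge_add_one_self) auto
    also have "\<dots> = exp x" by (simp flip: exp_add)
    finally have "exp y - exp x \<le> exp y * (y - x)" by (simp add: algebra_simps)
    also have "\<dots> \<le> exp c * (y - x)" using that by (intro mult_right_mono) auto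
    finally show ?thesis .
  qed
  from this[of a b] this[of b a] show ?thesis
    using assms by (cases "a \<le> b") auto
qed

text \<open>Taylor's formula leaves the remainder \<open>exp t * y\<^sup>2 / 2\<close> with
  \<open>\<bar>t\<bar> \<le> \<bar>y\<bar> \<le> \<delta>\<close>, and \<open>exp t\<close> lies
  between \<open>1 - \<delta>\<close> and \<open>1 + 2 * \<delta>\<close>.\<close>

lemma exp_quadratic_bounds:
  fixes y \<delta> :: real
  assumes "\<bar>y\<bar> \<le> \<delta>" "\<delta> \<le> 1/2"
  shows "1 + y + (1 - \<delta>) * y\<^sup>2 / 2 \<le> exp y" "exp y \<le> 1 + y + (1 + 2 * \<delta>) * y\<^sup>2 / 2"
proof -
  obtain t where t: "\<bar>t\<bar> \<le> \<bar>y\<bar>" "exp y = (\<Sum>m<2. y ^ m / fact m) + exp t / fact 2 * y ^ 2"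
    using Maclaurin_exp_le[of y 2] by auto
  have eq: "exp y = 1 + y + exp t * y\<^sup>2 / 2"
    using t(2) by (simp add: numeral_2_eq_2)
  have "1 - \<delta> \<le> exp t"
    using exp_ge_add_one_self[of t] t(1) assms by linarith
  then show "1 + y + (1 - \<delta>) * y\<^sup>2 / 2 \<le> exp y"
    unfolding eq by (auto intro!: mult_right_mono)
  have "exp t \<le> 1 + 2 * \<delta>"
    using exp_bound_lemma[of t] t(1) assms by simp
  then show "exp y \<le> 1 + y + (1 + 2 * \<delta>) * y\<^sup>2 / 2"
    unfolding eq by (auto intro!: mult_right_mono)
qed

text \<open>Turns an additive lower bound into an exponential one, so that the bounds of independent
  factors can be multiplied. With \<open>u = (1 - \<delta>) * v - r\<close> one has
  \<open>ln (1 + u) \<ge> u - 2 * u\<^sup>2\<close> and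
  \<open>u\<^sup>2 \<le> \<delta> * (v + r)\<close>, so the loss is at most
  \<open>2 * \<delta> * v + r\<close>.\<close>

lemma exp_le_one_plus_perturbed:
  fixes v r \<delta> :: real
  assumes v: "0 \<le> v" "v \<le> \<delta>" and r: "0 \<le> r" "r \<le> \<delta>" and \<delta>: "\<delta> \<le> 1/2"
  shows "exp ((1 - 3 * \<delta>) * v - 2 * r) \<le> 1 + ((1 - \<delta>) * v - r)"
proof -
  define u where "u = (1 - \<delta>) * v - r"
  have d0: "0 \<le> \<delta>" using v by linarith
  have p: "0 \<le> \<delta> * v" using d0 v by simp
  have q: "\<delta> * v \<le> v" using mult_right_mono[of \<delta> 1 v] \<delta> v by simp
  have u: "\<bar>u\<bar> \<le> \<delta>" "\<bar>u\<bar> \<le> v + r"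
    using p q v r by (simp_all only: u_def left_diff_distrib mult_1)
  have "u\<^sup>2 = \<bar>u\<bar> * \<bar>u\<bar>" by (simp add: power2_eq_square)
  also have "\<dots> \<le> \<delta> * (v + r)" using u d0 by (intro mult_mono) auto
  finally have usq: "u\<^sup>2 \<le> \<delta> * (v + r)" .
  have "\<delta> * r \<le> r / 2" using mult_right_mono[OF \<delta>, of r] r by simp
  have "(1 - 3 * \<delta>) * v - 2 * r \<le> u - 2 * u\<^sup>2"
    using usq \<open>\<delta> * r \<le> r / 2\<close> by (simp add: u_def algebra_simps)
  also have "\<dots> \<le> ln (1 + u)"
    using abs_ln_one_plus_x_minus_x_bound[of u] u(1) \<delta> by auto
  finally have "exp ((1 - 3 * \<delta>) * v - 2 * r) \<le> exp (ln (1 + u))" by simp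
  also have "\<dots> = 1 + u" using u(1) \<delta> by (intro exp_ln) linarith
  finally show ?thesis by (simp add: u_def)
qed

text \<open>Compares exponents, per unit of \<open>x\<^sup>2\<close>, of the tilt \<open>l\<close>
  with those of the tilts \<open>z\<close> and \<open>b\<close>. Without the errors
  \<open>\<delta>\<close> and \<open>\<theta>\<close> the first two gaps are
  \<open>(l - z)\<^sup>2 / 2\<close> and \<open>(b - l)\<^sup>2 / 2\<close>, both equal to
  \<open>z\<^sup>2 * \<eta>\<^sup>2 / 2\<close>; keeping only
  \<open>z\<^sup>2 * \<eta>\<^sup>2 / 8\<close> leaves room for the errors. In the third,
  \<open>l\<^sup>2 / 2 - l * b\<close> equals
  \<open>- (z\<^sup>2 / 2) * (1 + 4 * \<eta> + 3 * \<eta>\<^sup>2)\<close>, and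
  \<open>8 * \<eta>\<close> covers the remaining terms and the errors.\<close>

lemma tilt_polynomial_bounds:
  fixes \<eta> z :: real
  assumes \<eta>: "0 < \<eta>" "\<eta> \<le> 1"
  defines "\<delta> \<equiv> \<eta>\<^sup>2 / 60" and "\<theta> \<equiv> z * \<eta>\<^sup>2 / 56"
    and "l \<equiv> z * (1 + \<eta>)" and "b \<equiv> z * (1 + 2 * \<eta>)"
  shows "(l - z) * z + ((1 + 2 * \<delta>) * z\<^sup>2 / 2 + z * \<theta>) + z\<^sup>2 * \<eta>\<^sup>2 / 8
      \<le> (1 - 3 * \<delta>) * l\<^sup>2 / 2 - 2 * l * \<theta>"
    and "- (b - l) * b + ((1 + 2 * \<delta>) * b\<^sup>2 / 2 + b * \<theta>) + z\<^sup>2 * \<eta>\<^sup>2 / 8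
      \<le> (1 - 3 * \<delta>) * l\<^sup>2 / 2 - 2 * l * \<theta>"
    and "- (z\<^sup>2 / 2 * (1 + 8 * \<eta>)) \<le> (1 - 3 * \<delta>) * l\<^sup>2 / 2 - 2 * l * \<theta> - l * b"
proof -
  have h: "\<eta> ^ 4 \<le> \<eta>\<^sup>2" "\<eta> ^ 3 \<le> \<eta>\<^sup>2" "\<eta>\<^sup>2 \<le> \<eta> ^ 1"
    using \<eta> by (intro power_decreasing; simp)+
  \<comment> \<open>Divided by \<open>z\<^sup>2\<close>, the gap is a polynomial in
    \<open>\<eta>\<close>. Matching coefficients writes it as a nonnegative combination of the
    differences in \<open>h\<close> and a nonnegative rest.\<close>
  have "0 \<le> (\<eta>\<^sup>2 - \<eta> ^ 4) / 40 + 3 / 35 * (\<eta>\<^sup>2 - \<eta> ^ 3) + 71 / 420 * \<eta>\<^sup>2"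
    using h by (intro add_nonneg_nonneg) auto
  also have "\<dots> = (1 - \<eta>\<^sup>2 / 20) * (1 + \<eta>)\<^sup>2 / 2 - (1 + \<eta>) * \<eta>\<^sup>2 / 28
      - (\<eta> + (1 + \<eta>\<^sup>2 / 30) / 2 + \<eta>\<^sup>2 / 56 + \<eta>\<^sup>2 / 8)"
    by (simp add: field_simps power2_eq_square power3_eq_cube power4_eq_xxxx)
  finally have "0 \<le> \<dots>" .
  from mult_nonneg_nonneg[OF zero_le_power2[of z] this]
  show "(l - z) * z + ((1 + 2 * \<delta>) * z\<^sup>2 / 2 + z * \<theta>) + z\<^sup>2 * \<eta>\<^sup>2 / 8
      \<le> (1 - 3 * \<delta>) * l\<^sup>2 / 2 - 2 * l * \<theta>"
    by (simp add: \<delta>_def \<theta>_def l_def field_simps power2_eq_square)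
  have "0 \<le> (1 - \<eta>\<^sup>2 / 20) * (1 + \<eta>)\<^sup>2 / 2 - (1 + \<eta>) * \<eta>\<^sup>2 / 28
      - (- \<eta> * (1 + 2 * \<eta>) + (1 + \<eta>\<^sup>2 / 30) * (1 + 2 * \<eta>)\<^sup>2 / 2 + (1 + 2 * \<eta>) * \<eta>\<^sup>2 / 56 + \<eta>\<^sup>2 / 8)"
    using h by (simp add: field_simps power2_eq_square power3_eq_cube power4_eq_xxxx)
  from mult_nonneg_nonneg[OF zero_le_power2[of z] this]
  show "- (b - l) * b + ((1 + 2 * \<delta>) * b\<^sup>2 / 2 + b * \<theta>) + z\<^sup>2 * \<eta>\<^sup>2 / 8
      \<le> (1 - 3 * \<delta>) * l\<^sup>2 / 2 - 2 * l * \<theta>"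
    by (simp add: \<delta>_def \<theta>_def l_def b_def field_simps power2_eq_square)
  have "0 \<le> (\<eta>\<^sup>2 - \<eta> ^ 4) / 40 + 3 / 35 * (\<eta>\<^sup>2 - \<eta> ^ 3) + 117 / 70 * (\<eta> - \<eta>\<^sup>2) + 23 / 70 * \<eta>"
    using h \<eta> by (intro add_nonneg_nonneg) auto
  also have "\<dots> = (1 - \<eta>\<^sup>2 / 20) * (1 + \<eta>)\<^sup>2 / 2 - (1 + \<eta>) * \<eta>\<^sup>2 / 28
      - (1 + \<eta>) * (1 + 2 * \<eta>) + (1 + 8 * \<eta>) / 2"
    by (simp add: field_simps power2_eq_square power3_eq_cube power4_eq_xxxx)
  finally have "0 \<le> \<dots>" .
  from mult_nonneg_nonneg[OF zero_le_power2[of z] this]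
  show "- (z\<^sup>2 / 2 * (1 + 8 * \<eta>)) \<le> (1 - 3 * \<delta>) * l\<^sup>2 / 2 - 2 * l * \<theta> - l * b"
    by (simp add: \<delta>_def \<theta>_def l_def b_def field_simps power2_eq_square)
qed

section \<open>Finite expectations, exponential moments and products of independent
  variables\<close>

context sublinear_expectation_space
begin

lemma H_const: "(\<lambda>\<omega>. c) \<in> H"
  using H_comp[of 1 "\<lambda>_ \<omega>. 0" "\<lambda>_. c"] H_zero C_l_Lip_const by simp

lemma H_square: "X \<in> H \<Longrightarrow> (\<lambda>\<omega>. (X \<omega>)\<^sup>2) \<in> H"
  using H_comp[of 1 "\<lambda>_. X" "\<lambda>u. (u 1)\<^sup>2"] C_l_Lip_square by simp

lemma H_uminus: "X \<in> H \<Longrightarrow> (\<lambda>\<omega>. - X \<omega>) \<in> H"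
  using H_scale[of X "-1"] by simp

text \<open>Boundedness makes the expectations below finite, which moves the extended arithmetic to
  the reals.\<close>

lemma E_bounded:
  assumes "Y \<in> H" "\<And>\<omega>. \<omega> \<in> space M \<Longrightarrow> a \<le> Y \<omega>" "\<And>\<omega>. \<omega> \<in> space M \<Longrightarrow> Y \<omega> \<le> b"
  obtains r where "E Y = ereal r" "a \<le> r" "r \<le> b"
proof -
  have "ereal a \<le> E Y" "E Y \<le> ereal b"
    using E_mono[OF assms(1) H_const[of a]] E_mono[OF H_const[of b] assms(1)] assms(2,3)
    by (auto simp: E_const)
  then show thesis by (cases "E Y") (auto intro: that)
qed

lemma E_subadd_real:
  assumes "X \<in> H" "Y \<in> H" "E X = ereal a" "E Y = ereal b"
  shows "E (\<lambda>\<omega>. X \<omega> + Y \<omega>) \<le> ereal (a + b)"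
  using E_subadd[OF assms(1,2)] assms(3,4) by simp

text \<open>The expectation is applied to the quadratic bounds of
  \<open>exp (t * X \<omega>)\<close>. \<open>Y\<close> stands for any member of \<open>H\<close>
  that agrees with this exponential on the space, for instance one obtained by truncation.\<close>

lemma E_exp_bounds:
  assumes X: "X \<in> H" and bnd: "\<And>\<omega>. \<omega> \<in> space M \<Longrightarrow> \<bar>X \<omega>\<bar> \<le> B"
    and t: "0 \<le> t" "t * B \<le> \<delta>" "\<delta> \<le> 1/2"
    and Y: "Y \<in> H" "\<And>\<omega>. \<omega> \<in> space M \<Longrightarrow> Y \<omega> = exp (t * X \<omega>)"
    and p: "E X = ereal p" and q: "E (\<lambda>\<omega>. - X \<omega>) = ereal q"
    and v: "E (\<lambda>\<omega>. (X \<omega>)\<^sup>2) = ereal v"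
  obtains m where "E Y = ereal m"
    "exp ((1 - 3 * \<delta>) * (t\<^sup>2 * v / 2) - 2 * t * \<bar>q\<bar>) \<le> m"
    "m \<le> exp ((1 + 2 * \<delta>) * (t\<^sup>2 * v / 2) + t * \<bar>p\<bar>)"
proof -
  \<comment> \<open>On an empty space monotonicity would hold vacuously and give
    \<open>0 \<ge> 1\<close>. A point of the space is needed to read off
    \<open>0 \<le> B\<close>.\<close>
  have "space M \<noteq> {}"
  proof
    assume "space M = {}"
    then have "E (\<lambda>\<omega>. 0) \<ge> E (\<lambda>\<omega>. 1)" by (intro E_mono H_const) auto
    then show False by (simp add: E_const)
  qed
  then have B: "0 \<le> B" using bnd by force
  have tX: "\<bar>t * X \<omega>\<bar> \<le> \<delta>" if "\<omega> \<in> space M" for \<omega>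
    using mult_left_mono[OF bnd[OF that] t(1)] t by (simp add: abs_mult)
  have d0: "0 \<le> \<delta>" using B t mult_nonneg_nonneg[OF t(1) B] by linarith
  obtain m where m: "E Y = ereal m"
  proof (rule E_bounded[OF Y(1)])
    show "0 \<le> Y \<omega>" "Y \<omega> \<le> exp \<delta>" if "\<omega> \<in> space M" for \<omega>
      using Y(2)[OF that] tX[OF that] by auto
  qed
  obtain v' where v': "E (\<lambda>\<omega>. (X \<omega>)\<^sup>2) = ereal v'" "0 \<le> v'" "v' \<le> B\<^sup>2"
  proof (rule E_bounded[OF H_square[OF X]])
    show "(X \<omega>)\<^sup>2 \<le> B\<^sup>2" if "\<omega> \<in> space M" for \<omega>
      using bnd[OF that] by (metis abs_ge_zero power2_abs power_mono)
  qed auto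
  then have v0: "0 \<le> v" "v \<le> B\<^sup>2" using v by auto
  obtain q' where q': "E (\<lambda>\<omega>. - X \<omega>) = ereal q'" "-B \<le> q'" "q' \<le> B"
    by (rule E_bounded[OF H_uminus[OF X], of "-B" B])
      (use bnd in \<open>auto simp: abs_le_iff minus_le_iff\<close>)
  then have q0: "\<bar>q\<bar> \<le> B" using q by auto
  \<comment> \<open>Sub-additivity bounds sums only from above. So the quadratic term is placed
    below \<open>Y - t * X - 1\<close>, and the linear term enters through the expectation of
    \<open>- X\<close>.\<close>
  have lo: "1 + ((1 - \<delta>) * (t\<^sup>2 * v / 2) - t * q) \<le> m"
  proof -
    define c where "c = (1 - \<delta>) * t\<^sup>2 / 2"
    have c: "0 \<le> c" using t d0 by (auto simp: c_def)
    have Yq: "(\<lambda>\<omega>. Y \<omega> + t * (- X \<omega>)) \<in> H" by (intro H_add H_scale H_uminus X Y)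
    have "E (\<lambda>\<omega>. Y \<omega> + t * (- X \<omega>)) \<le> ereal (m + t * q)"
      by (rule E_subadd_real) (use m q E_scale[OF H_uminus[OF X] t(1)] H_scale[OF H_uminus[OF X], of t] in \<open>simp_all add: Y\<close>)
    then have *: "E (\<lambda>\<omega>. (Y \<omega> + t * (- X \<omega>)) + (-1)) \<le> ereal (m + t * q) + ereal (-1)"
      by (intro order_trans[OF E_subadd[OF Yq H_const]] add_mono) (auto simp: E_const)
    have "ereal (c * v) = E (\<lambda>\<omega>. c * (X \<omega>)\<^sup>2)"
      using E_scale[OF H_square[OF X] c] v by simp
    also have "\<dots> \<le> E (\<lambda>\<omega>. (Y \<omega> + t * (- X \<omega>)) + (-1))"
    proof (rule E_mono)
      show "(\<lambda>\<omega>. (Y \<omega> + t * (- X \<omega>)) + (-1)) \<in> H" by (rule H_add[OF Yq H_const])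
      show "(\<lambda>\<omega>. c * (X \<omega>)\<^sup>2) \<in> H" by (rule H_scale[OF H_square[OF X]])
      show "c * (X \<omega>)\<^sup>2 \<le> (Y \<omega> + t * (- X \<omega>)) + (-1)" if "\<omega> \<in> space M" for \<omega>
        using exp_quadratic_bounds(1)[OF tX[OF that] t(3)] Y(2)[OF that]
        by (simp add: c_def power_mult_distrib)
    qed
    finally show ?thesis using * by (auto simp: c_def dest: order_trans)
  qed
  have up: "m \<le> 1 + (t * p + (1 + 2 * \<delta>) * (t\<^sup>2 * v / 2))"
  proof -
    define c where "c = (1 + 2 * \<delta>) * t\<^sup>2 / 2"
    have c: "0 \<le> c" using t d0 by (auto simp: c_def)
    have R: "(\<lambda>\<omega>. t * X \<omega> + c * (X \<omega>)\<^sup>2) \<in> H" by (intro H_add H_scale H_square X)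
    have "E (\<lambda>\<omega>. t * X \<omega> + c * (X \<omega>)\<^sup>2) \<le> ereal (t * p + c * v)"
      by (rule E_subadd_real) (use p v t c in \<open>simp_all add: H_scale H_square X E_scale\<close>)
    then have *: "E (\<lambda>\<omega>. (t * X \<omega> + c * (X \<omega>)\<^sup>2) + 1) \<le> ereal (t * p + c * v) + ereal 1"
      by (intro order_trans[OF E_subadd[OF R H_const]] add_mono) (auto simp: E_const)
    have "E Y \<le> E (\<lambda>\<omega>. (t * X \<omega> + c * (X \<omega>)\<^sup>2) + 1)"
    proof (rule E_mono[OF _ Y(1)])
      show "(\<lambda>\<omega>. (t * X \<omega> + c * (X \<omega>)\<^sup>2) + 1) \<in> H" by (rule H_add[OF R H_const])
      show "Y \<omega> \<le> (t * X \<omega> + c * (X \<omega>)\<^sup>2) + 1" if "\<omega> \<in> space M" for \<omega>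
        using exp_quadratic_bounds(2)[OF tX[OF that] t(3)] Y(2)[OF that]
        by (simp add: c_def power_mult_distrib)
    qed
    from order_trans[OF this *] show ?thesis using m by (simp add: c_def)
  qed
  show thesis
  proof (rule that[OF m])
    \<comment> \<open>\<open>t\<^sup>2 * v / 2\<close> and \<open>t * \<bar>q\<bar>\<close> become
      the \<open>v\<close> and \<open>r\<close> of \<open>exp_le_one_plus_perturbed\<close>, so both
      have to be at most \<open>\<delta>\<close>.\<close>
    have tb: "t\<^sup>2 * v \<le> \<delta>"
    proof -
      have "t\<^sup>2 * v \<le> t\<^sup>2 * B\<^sup>2" using v0 by (intro mult_left_mono) auto
      also have "\<dots> = (t * B) * (t * B)" by (simp add: power2_eq_square)
      also have "\<dots> \<le> \<delta> * 1" using t B d0 by (intro mult_mono) auto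
      finally show ?thesis by simp
    qed
    have tv: "0 \<le> t\<^sup>2 * v" using v0 by simp
    have "t * \<bar>q\<bar> \<le> \<delta>" using mult_left_mono[OF q0 t(1)] t by linarith
    then have "exp ((1 - 3 * \<delta>) * (t\<^sup>2 * v / 2) - 2 * (t * \<bar>q\<bar>)) \<le> 1 + ((1 - \<delta>) * (t\<^sup>2 * v / 2) - t * \<bar>q\<bar>)"
      using tb tv t by (intro exp_le_one_plus_perturbed) auto
    also have "\<dots> \<le> m" using lo mult_left_mono[OF abs_ge_self[of q] t(1)] by linarith
    finally show "exp ((1 - 3 * \<delta>) * (t\<^sup>2 * v / 2) - 2 * t * \<bar>q\<bar>) \<le> m" by (simp add: mult_ac)
    have "m \<le> 1 + ((1 + 2 * \<delta>) * (t\<^sup>2 * v / 2) + t * \<bar>p\<bar>)"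
      using up mult_left_mono[OF abs_ge_self[of p] t(1)] by linarith
    also have "\<dots> \<le> exp ((1 + 2 * \<delta>) * (t\<^sup>2 * v / 2) + t * \<bar>p\<bar>)" by (rule exp_ge_add_one_self)
    finally show "m \<le> exp ((1 + 2 * \<delta>) * (t\<^sup>2 * v / 2) + t * \<bar>p\<bar>)" .
  qed
qed

text \<open>Induction on the number of factors. Freezing the first \<open>j\<close> variables leaves
  a nonnegative constant times one factor, and nonnegative constants come out of a sub-linear
  expectation exactly.\<close>

lemma E_prod_independent:
  fixes g :: "real \<Rightarrow> real"
  assumes pos: "\<And>a. 0 \<le> g a" and bnd: "\<And>a. g a \<le> K"
    and lip: "\<And>a b. \<bar>g a - g b\<bar> \<le> L * \<bar>a - b\<bar>"
    and X: "\<And>i. i \<in> {1..k} \<Longrightarrow> X i \<in> H" and ind: "independent_rvs H E k X"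
    and m: "\<And>i. i \<in> {1..k} \<Longrightarrow> E (\<lambda>\<omega>. g (X i \<omega>)) = ereal (m i)"
  shows "E (\<lambda>\<omega>. \<Prod>i=1..k. g (X i \<omega>)) = ereal (\<Prod>i=1..k. m i)"
    and "(\<lambda>\<omega>. \<Prod>i=1..k. g (X i \<omega>)) \<in> H"
proof -
  have lips: "(\<lambda>u. \<Prod>i=1..n. g (u i)) \<in> C_l_Lip n" for n
    using pos bnd lip by (intro C_l_Lip_prod[of g K L]) auto
  \<comment> \<open>\<open>H_comp\<close> asks for at least one coordinate; the empty product is the
    constant 1.\<close>
  have inH: "(\<lambda>\<omega>. \<Prod>i=1..j. g (X i \<omega>)) \<in> H" if "j \<le> k" for j
  proof (cases "j = 0")
    case False
    then show ?thesis
      using H_comp[of j X "\<lambda>u. \<Prod>i=1..j. g (u i)"] that lips[of j] X by auto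
  qed (simp add: H_const)
  have gH: "(\<lambda>\<omega>. g (X i \<omega>)) \<in> H" if "i \<in> {1..k}" for i
    using H_comp[of 1 "\<lambda>_. X i" "\<lambda>u. \<Prod>i=1..1. g (u i)"] lips[of 1] X[OF that] by simp
  have "j \<le> k \<Longrightarrow> E (\<lambda>\<omega>. \<Prod>i=1..j. g (X i \<omega>)) = ereal (\<Prod>i=1..j. m i)" for j
  proof (induction j)
    case 0
    then show ?case by (simp add: E_const)
  next
    case (Suc j)
    \<comment> \<open>Independence starts with the second variable, so the first factor is treated
      apart.\<close>
    show ?case
    proof (cases "j = 0")
      case True
      then show ?thesis using m[of 1] Suc.prems by simp
    next
      case False
      define f where "f = (\<lambda>u. \<Prod>i=1..j. g (u i))"
      define \<phi> where "\<phi> = (\<lambda>u. \<Prod>i=1..Suc j. g (u i))"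
      let ?m = "m (Suc j)"
      have f0: "0 \<le> f u" for u unfolding f_def by (intro prod_nonneg) (auto simp: pos)
      have \<phi>: "\<phi> (append_vec j u (\<lambda>_. y)) = f u * g y" for u y
        by (simp add: \<phi>_def f_def append_vec_def)
      have in1: "Suc j \<in> {1..k}" using Suc.prems by simp
      have E\<phi>: "E (\<lambda>\<omega>. f u * g (X (Suc j) \<omega>)) = ereal (f u * ?m)" for u
        using E_scale[OF gH[OF in1] f0] m[OF in1] by simp
      have fH: "(\<lambda>\<omega>. f (\<lambda>i. X i \<omega>)) \<in> H" using inH[of j] Suc.prems by (simp add: f_def)
      obtain m' where m': "E (\<lambda>\<omega>. g (X (Suc j) \<omega>)) = ereal m'" "0 \<le> m'"
        by (rule E_bounded[OF gH[OF in1]]) (use pos bnd in auto)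
      have m0: "0 \<le> ?m" using m' m[OF in1] by simp
      have IH: "E (\<lambda>\<omega>. f (\<lambda>i. X i \<omega>)) = ereal (\<Prod>i=1..j. m i)"
        using Suc by (simp add: f_def)
      have Ef: "E (\<lambda>\<omega>. f (\<lambda>i. X i \<omega>) * ?m) = ereal ((\<Prod>i=1..j. m i) * ?m)"
        using E_scale[OF fH m0] IH by (simp add: mult.commute)
      have fmH: "(\<lambda>\<omega>. f (\<lambda>i. X i \<omega>) * ?m) \<in> H"
        using H_scale[OF fH, of ?m] by (simp add: mult.commute)
      have "independent_to H E 1 (\<lambda>_. X (Suc j)) j X"
        using ind False Suc.prems by (auto simp: independent_rvs_def)
      \<comment> \<open>Since \<open>\<phi>\<close> is nonnegative, absolute values change nothing,
        and both inner expectations are \<open>f u * m (Suc j)\<close>. The side conditions then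
        reduce to \<open>fmH\<close> and \<open>Ef\<close>.\<close>
      then have "E (\<lambda>\<omega>. \<phi> (append_vec j (\<lambda>i. X i \<omega>) (\<lambda>_. X (Suc j) \<omega>)))
          = E (\<lambda>\<omega>. f (\<lambda>i. X i \<omega>) * ?m)"
        unfolding independent_to_def Let_def
        by (elim ballE[where x = \<phi>])
          (use lips[of "Suc j", folded \<phi>_def] fmH f0 pos m0 in \<open>simp_all add: \<phi> E\<phi> Ef abs_mult\<close>)
      then show ?thesis by (simp add: \<phi> Ef) (simp add: f_def)
    qed
  qed
  then show "E (\<lambda>\<omega>. \<Prod>i=1..k. g (X i \<omega>)) = ereal (\<Prod>i=1..k. m i)" by simp
  show "(\<lambda>\<omega>. \<Prod>i=1..k. g (X i \<omega>)) \<in> H" using inH by simp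
qed

text \<open>The bounds for single variables are exponentials, so multiplying them adds the second
  moments and the absolute means.\<close>

lemma E_exp_sum_bounds:
  assumes X: "\<And>i. i \<in> {1..k} \<Longrightarrow> X i \<in> H" and ind: "independent_rvs H E k X"
    and bnd: "\<And>i \<omega>. i \<in> {1..k} \<Longrightarrow> \<omega> \<in> space M \<Longrightarrow> \<bar>X i \<omega>\<bar> \<le> B"
    and t: "0 \<le> t" "t * B \<le> \<delta>" "\<delta> \<le> 1/2" and B: "0 \<le> B"
    and p: "\<And>i. i \<in> {1..k} \<Longrightarrow> E (X i) = ereal (p i)"
    and q: "\<And>i. i \<in> {1..k} \<Longrightarrow> E (\<lambda>\<omega>. - X i \<omega>) = ereal (q i)"
    and v: "\<And>i. i \<in> {1..k} \<Longrightarrow> E (\<lambda>\<omega>. (X i \<omega>)\<^sup>2) = ereal (v i)"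
  obtains F m where "F \<in> H" "\<forall>\<omega>\<in>space M. F \<omega> = exp (t * (\<Sum>i=1..k. X i \<omega>))" "E F = ereal m"
    "exp ((1 - 3 * \<delta>) * (t\<^sup>2 * (\<Sum>i=1..k. v i) / 2) - 2 * t * (\<Sum>i=1..k. \<bar>q i\<bar>)) \<le> m"
    "m \<le> exp ((1 + 2 * \<delta>) * (t\<^sup>2 * (\<Sum>i=1..k. v i) / 2) + t * (\<Sum>i=1..k. \<bar>p i\<bar>))"
proof -
  text \<open>Truncating at the bound of the \<open>X i\<close> makes the exponential globally Lipschitz.\<close>
  define g where "g = (\<lambda>y. exp (t * max (- B) (min B y)))"
  have g0: "0 \<le> g y" for y by (simp add: g_def)
  have le: "t * max (- B) (min B y) \<le> t * B" for y
    using t B by (intro mult_left_mono) auto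
  have gK: "g y \<le> exp (t * B)" for y using le by (simp add: g_def)
  have gL: "\<bar>g a - g b\<bar> \<le> (exp (t * B) * t) * \<bar>a - b\<bar>" for a b
  proof -
    have "\<bar>g a - g b\<bar> \<le> exp (t * B) * \<bar>t * max (- B) (min B a) - t * max (- B) (min B b)\<bar>"
      unfolding g_def by (intro exp_Lipschitz_below le)
    also have "\<dots> = exp (t * B) * t * \<bar>max (- B) (min B a) - max (- B) (min B b)\<bar>"
      using t by (simp add: abs_mult flip: right_diff_distrib)
    also have "\<dots> \<le> exp (t * B) * t * \<bar>a - b\<bar>"
      using t B by (intro mult_left_mono) auto
    finally show ?thesis .
  qed
  have gX: "g (X i \<omega>) = exp (t * X i \<omega>)" if "i \<in> {1..k}" "\<omega> \<in> space M" for i \<omega>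
    using bnd[OF that] by (auto simp: g_def abs_le_iff max_def min_def)
  have gH: "(\<lambda>\<omega>. g (X i \<omega>)) \<in> H" if "i \<in> {1..k}" for i
    using H_comp[of 1 "\<lambda>_. X i" "\<lambda>u. \<Prod>i=1..1. g (u i)"] X[OF that]
      C_l_Lip_prod[of g "exp (t * B)" "exp (t * B) * t" 1] g0 gK gL by simp
  have "\<exists>m. E (\<lambda>\<omega>. g (X i \<omega>)) = ereal m \<and>
      exp ((1 - 3 * \<delta>) * (t\<^sup>2 * v i / 2) - 2 * t * \<bar>q i\<bar>) \<le> m \<and>
      m \<le> exp ((1 + 2 * \<delta>) * (t\<^sup>2 * v i / 2) + t * \<bar>p i\<bar>)" if "i \<in> {1..k}" for i
    by (rule E_exp_bounds[OF X bnd t gH gX p q v]) (use that in auto)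
  then obtain m where m: "\<And>i. i \<in> {1..k} \<Longrightarrow> E (\<lambda>\<omega>. g (X i \<omega>)) = ereal (m i)"
      "\<And>i. i \<in> {1..k} \<Longrightarrow> exp ((1 - 3 * \<delta>) * (t\<^sup>2 * v i / 2) - 2 * t * \<bar>q i\<bar>) \<le> m i"
      "\<And>i. i \<in> {1..k} \<Longrightarrow> m i \<le> exp ((1 + 2 * \<delta>) * (t\<^sup>2 * v i / 2) + t * \<bar>p i\<bar>)"
    by metis
  have E: "E (\<lambda>\<omega>. \<Prod>i=1..k. g (X i \<omega>)) = ereal (\<Prod>i=1..k. m i)"
    by (rule E_prod_independent(1)[OF g0 gK gL X ind m(1)])
  have H: "(\<lambda>\<omega>. \<Prod>i=1..k. g (X i \<omega>)) \<in> H"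
    by (rule E_prod_independent(2)[OF g0 gK gL X ind m(1)])
  show thesis
  proof (rule that[OF H _ E])
    show "\<forall>\<omega>\<in>space M. (\<Prod>i=1..k. g (X i \<omega>)) = exp (t * (\<Sum>i=1..k. X i \<omega>))"
      using gX by (simp add: exp_sum sum_distrib_left)
    have "exp ((1 - 3 * \<delta>) * (t\<^sup>2 * (\<Sum>i=1..k. v i) / 2) - 2 * t * (\<Sum>i=1..k. \<bar>q i\<bar>))
        = (\<Prod>i=1..k. exp ((1 - 3 * \<delta>) * (t\<^sup>2 * v i / 2) - 2 * t * \<bar>q i\<bar>))"
      by (simp add: sum_subtractf sum_distrib_left sum_divide_distrib flip: exp_sum)
    also have "\<dots> \<le> (\<Prod>i=1..k. m i)" by (intro prod_mono conjI m(2)) auto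
    finally show "exp ((1 - 3 * \<delta>) * (t\<^sup>2 * (\<Sum>i=1..k. v i) / 2) - 2 * t * (\<Sum>i=1..k. \<bar>q i\<bar>))
        \<le> (\<Prod>i=1..k. m i)" .
    have "(\<Prod>i=1..k. m i) \<le> (\<Prod>i=1..k. exp ((1 + 2 * \<delta>) * (t\<^sup>2 * v i / 2) + t * \<bar>p i\<bar>))"
      by (intro prod_mono conjI m(3)) (use m(2) in \<open>auto intro: order_trans[OF exp_ge_zero]\<close>)
    also have "\<dots> = exp ((1 + 2 * \<delta>) * (t\<^sup>2 * (\<Sum>i=1..k. v i) / 2) + t * (\<Sum>i=1..k. \<bar>p i\<bar>))"
      by (simp add: sum.distrib sum_distrib_left sum_divide_distrib flip: exp_sum)
    finally show "(\<Prod>i=1..k. m i)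
        \<le> exp ((1 + 2 * \<delta>) * (t\<^sup>2 * (\<Sum>i=1..k. v i) / 2) + t * (\<Sum>i=1..k. \<bar>p i\<bar>))" .
  qed
qed

section \<open>Lower bound for one row by exponential tilting\<close>

lemma capacity_tail_lower_bound:
  assumes C: "property_C M H E V"
    and X: "\<And>i. i \<in> {1..k} \<Longrightarrow> X i \<in> H" and ind: "independent_rvs H E k X"
    and bnd: "\<And>i \<omega>. i \<in> {1..k} \<Longrightarrow> \<omega> \<in> space M \<Longrightarrow> \<bar>X i \<omega>\<bar> \<le> B" and B: "0 \<le> B"
    and p: "\<And>i. i \<in> {1..k} \<Longrightarrow> E (X i) = ereal (p i)"
    and q: "\<And>i. i \<in> {1..k} \<Longrightarrow> E (\<lambda>\<omega>. - X i \<omega>) = ereal (q i)"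
    and v: "\<And>i. i \<in> {1..k} \<Longrightarrow> E (\<lambda>\<omega>. (X i \<omega>)\<^sup>2) = ereal (v i)"
    and s: "0 < s" "s\<^sup>2 = (\<Sum>i=1..k. v i)" and x: "0 < x" and z: "0 < z" and \<eta>: "0 < \<eta>" "\<eta> \<le> 1"
    and small: "z * (1 + 2 * \<eta>) * x / s * B \<le> \<eta>\<^sup>2 / 60"
    and P: "(\<Sum>i=1..k. \<bar>p i\<bar>) \<le> z * \<eta>\<^sup>2 / 56 * (s * x)"
    and Q: "(\<Sum>i=1..k. \<bar>q i\<bar>) \<le> z * \<eta>\<^sup>2 / 56 * (s * x)"
    and large: "exp (- (z\<^sup>2 * \<eta>\<^sup>2 / 8) * x\<^sup>2) \<le> 1 / 4"
  shows "exp (- (z\<^sup>2 / 2 * (1 + 8 * \<eta>)) * x\<^sup>2) / 2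
    \<le> V {\<omega> \<in> space M. z * s * x \<le> (\<Sum>i=1..k. X i \<omega>)}" (is "_ \<le> V ?A")
proof -
  \<comment> \<open>\<open>\<delta>\<close> is the expansion error that \<open>small\<close> allows
    at the largest tilt \<open>b\<close>; \<open>\<theta>\<close> is the drift, relative to
    \<open>s * x\<close>, that \<open>P\<close> and \<open>Q\<close> allow. Both are small multiples
    of \<open>\<eta>\<^sup>2\<close>, the order of the gap between the tilts.\<close>
  define \<delta> where "\<delta> = \<eta>\<^sup>2 / 60"
  define \<theta> where "\<theta> = z * \<eta>\<^sup>2 / 56"
  define l where "l = z * (1 + \<eta>)"
  define b where "b = z * (1 + 2 * \<eta>)"
  define W where "W = (\<lambda>\<omega>. (\<Sum>i=1..k. X i \<omega>) / (s * x))"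
  define lo where "lo = (1 - 3 * \<delta>) * l\<^sup>2 / 2 - 2 * l * \<theta>"
  define up where "up = (\<lambda>c. (1 + 2 * \<delta>) * c\<^sup>2 / 2 + c * \<theta>)"
  note poly = tilt_polynomial_bounds[OF \<eta>, of z, folded \<delta>_def \<theta>_def l_def b_def, folded lo_def]
  have \<eta>2: "\<eta>\<^sup>2 \<le> 1" "0 < \<eta>\<^sup>2" using \<eta> by (auto simp: power_le_one)
  have order: "0 < z" "z < l" "l < b" using z \<eta> by (auto simp: l_def b_def)
  have mgf: "\<exists>F m. F \<in> H \<and> (\<forall>\<omega>\<in>space M. F \<omega> = exp (c * x\<^sup>2 * W \<omega>)) \<and> E F = ereal m \<and>
      exp (((1 - 3 * \<delta>) * c\<^sup>2 / 2 - 2 * c * \<theta>) * x\<^sup>2) \<le> m \<and> m \<le> exp (up c * x\<^sup>2)"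
    if c: "0 < c" "c \<le> b" for c
  proof -
    \<comment> \<open>This scaling turns \<open>?t\<close> times the sum into
      \<open>c * x\<^sup>2 * W \<omega>\<close>, and \<open>?t\<^sup>2 * s\<^sup>2\<close> into
      \<open>c\<^sup>2 * x\<^sup>2\<close>.\<close>
    let ?t = "c * x / s"
    have t: "0 \<le> ?t" using c x s by simp
    have "?t * B \<le> b * x / s * B"
      using c x s B by (intro mult_right_mono divide_right_mono) auto
    also have "\<dots> \<le> \<delta>" using small by (simp add: b_def \<delta>_def)
    finally have tB: "?t * B \<le> \<delta>" .
    have \<delta>: "\<delta> \<le> 1 / 2" using \<eta>2 by (simp add: \<delta>_def)
    obtain F m where F: "F \<in> H" "\<forall>\<omega>\<in>space M. F \<omega> = exp (?t * (\<Sum>i=1..k. X i \<omega>))" "E F = ereal m"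
        "exp ((1 - 3 * \<delta>) * (?t\<^sup>2 * (\<Sum>i=1..k. v i) / 2) - 2 * ?t * (\<Sum>i=1..k. \<bar>q i\<bar>)) \<le> m"
        "m \<le> exp ((1 + 2 * \<delta>) * (?t\<^sup>2 * (\<Sum>i=1..k. v i) / 2) + ?t * (\<Sum>i=1..k. \<bar>p i\<bar>))"
      by (rule E_exp_sum_bounds[OF X ind bnd t tB \<delta> B p q v]; (assumption | rule that))
    have t2: "?t\<^sup>2 * (\<Sum>i=1..k. v i) = c\<^sup>2 * x\<^sup>2"
      unfolding s(2)[symmetric] using s(1) by (simp add: power_mult_distrib power_divide)
    have tth: "?t * (\<theta> * (s * x)) = c * \<theta> * x\<^sup>2"
      using s by (simp add: power2_eq_square)
    have tP: "?t * (\<Sum>i=1..k. \<bar>p i\<bar>) \<le> c * \<theta> * x\<^sup>2"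
      using mult_left_mono[OF P t] tth by (simp add: \<theta>_def)
    have tQ: "?t * (\<Sum>i=1..k. \<bar>q i\<bar>) \<le> c * \<theta> * x\<^sup>2"
      using mult_left_mono[OF Q t] tth by (simp add: \<theta>_def)
    show ?thesis
    proof (intro exI conjI ballI)
      show "F \<in> H" by fact
      show "E F = ereal m" by fact
      show "F \<omega> = exp (c * x\<^sup>2 * W \<omega>)" if "\<omega> \<in> space M" for \<omega>
        using bspec[OF F(2) that] s x by (simp add: W_def power2_eq_square)
      have "((1 - 3 * \<delta>) * c\<^sup>2 / 2 - 2 * c * \<theta>) * x\<^sup>2
          = (1 - 3 * \<delta>) * (c\<^sup>2 * x\<^sup>2 / 2) - 2 * (c * \<theta> * x\<^sup>2)" by (simp add: algebra_simps)
      also have "\<dots> \<le> (1 - 3 * \<delta>) * (c\<^sup>2 * x\<^sup>2 / 2) - 2 * ?t * (\<Sum>i=1..k. \<bar>q i\<bar>)"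
        using tQ by simp
      finally show "exp (((1 - 3 * \<delta>) * c\<^sup>2 / 2 - 2 * c * \<theta>) * x\<^sup>2) \<le> m"
        using F(4) unfolding t2 by (meson exp_le_cancel_iff order_trans)
      have "(1 + 2 * \<delta>) * (c\<^sup>2 * x\<^sup>2 / 2) + ?t * (\<Sum>i=1..k. \<bar>p i\<bar>)
          \<le> (1 + 2 * \<delta>) * (c\<^sup>2 * x\<^sup>2 / 2) + c * \<theta> * x\<^sup>2" using tP by simp
      also have "\<dots> = up c * x\<^sup>2" by (simp add: up_def algebra_simps)
      finally show "m \<le> exp (up c * x\<^sup>2)"
        using F(5) unfolding t2 by (meson exp_le_cancel_iff order_trans)
    qed
  qed
  obtain F0 m0 where F0: "F0 \<in> H" "\<And>\<omega>. \<omega> \<in> space M \<Longrightarrow> F0 \<omega> = exp (l * x\<^sup>2 * W \<omega>)"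
      "E F0 = ereal m0" "exp (lo * x\<^sup>2) \<le> m0"
    using mgf[of l] order unfolding lo_def by auto
  obtain F1 m1 where F1: "F1 \<in> H" "\<And>\<omega>. \<omega> \<in> space M \<Longrightarrow> F1 \<omega> = exp (z * x\<^sup>2 * W \<omega>)"
      "E F1 = ereal m1" "m1 \<le> exp (up z * x\<^sup>2)"
    using mgf[of z] order by auto
  obtain F2 m2 where F2: "F2 \<in> H" "\<And>\<omega>. \<omega> \<in> space M \<Longrightarrow> F2 \<omega> = exp (b * x\<^sup>2 * W \<omega>)"
      "E F2 = ereal m2" "m2 \<le> exp (up b * x\<^sup>2)"
    using mgf[of b] order by auto
  \<comment> \<open>\<open>c1\<close> makes the exponentials with tilts \<open>z\<close> and
    \<open>l\<close> meet at \<open>W = z\<close>, and \<open>c2\<close> makes those with tilts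
    \<open>b\<close> and \<open>l\<close> meet at \<open>W = b\<close>. \<open>K\<close> normalizes
    the tilt \<open>l\<close> to 1 at \<open>W = b\<close>.\<close>
  define c1 where "c1 = exp ((l - z) * z * x\<^sup>2)"
  define c2 where "c2 = exp (- (b - l) * b * x\<^sup>2)"
  define K where "K = exp (- l * b * x\<^sup>2)"
  define R where "R = (\<lambda>\<omega>. K * c1 * F1 \<omega> + K * c2 * F2 \<omega>)"
  define f where "f = (\<lambda>\<omega>. K * F0 \<omega> + (-1) * R \<omega>)"
  have pos: "0 < c1" "0 < c2" "0 < K" by (auto simp: c1_def c2_def K_def)
  have RH: "R \<in> H" unfolding R_def by (intro H_add H_scale F1 F2)
  have fH: "f \<in> H" unfolding f_def by (intro H_add H_scale F0 RH)
  have "(\<lambda>\<omega>. \<Sum>i=1..k. X i \<omega>) \<in> borel_measurable M"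
    using X H_measurable by (intro borel_measurable_sum) auto
  then have A: "?A \<in> sets M" by measurable
  have f_le: "f \<omega> \<le> indicator ?A \<omega>" if \<omega>: "\<omega> \<in> space M" for \<omega>
  proof -
    let ?w = "W \<omega>"
    have R0: "0 \<le> K * c1 * F1 \<omega>" "0 \<le> K * c2 * F2 \<omega>"
      using pos F1(2)[OF \<omega>] F2(2)[OF \<omega>] by auto
    have iff: "\<omega> \<in> ?A \<longleftrightarrow> z \<le> ?w"
      using \<omega> s x by (simp add: W_def pos_le_divide_eq mult.assoc)
    consider "?w < z" | "z \<le> ?w" "?w \<le> b" | "z \<le> ?w" "b < ?w" by linarith
    then show ?thesis
    proof cases
      case 1
      have "0 \<le> (l - z) * (z - ?w)" using 1 order by simp
      then have "l * ?w \<le> (l - z) * z + z * ?w" by (simp add: algebra_simps)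
      from mult_right_mono[OF this zero_le_power2[of x]]
      have "F0 \<omega> \<le> c1 * F1 \<omega>"
        by (simp add: F0(2)[OF \<omega>] F1(2)[OF \<omega>] c1_def algebra_simps flip: exp_add)
      then have "K * F0 \<omega> \<le> K * c1 * F1 \<omega>" using pos by (simp add: mult.assoc)
      then show ?thesis using R0 1 iff by (simp add: f_def R_def)
    next
      case 2
      have "l * ?w \<le> l * b" using 2 order by simp
      from mult_right_mono[OF this zero_le_power2[of x]]
      have "K * F0 \<omega> \<le> 1"
        by (simp add: F0(2)[OF \<omega>] K_def algebra_simps flip: exp_add)
      then show ?thesis using R0 2 iff by (simp add: f_def R_def)
    next
      case 3
      have "0 \<le> (b - l) * (?w - b)" using 3 order by simp
      then have "l * ?w \<le> - (b - l) * b + b * ?w" by (simp add: algebra_simps)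
      from mult_right_mono[OF this zero_le_power2[of x]]
      have "F0 \<omega> \<le> c2 * F2 \<omega>"
        by (simp add: F0(2)[OF \<omega>] F2(2)[OF \<omega>] c2_def algebra_simps flip: exp_add)
      then have "K * F0 \<omega> \<le> K * c2 * F2 \<omega>" using pos by (simp add: mult.assoc)
      then show ?thesis using R0 3 iff by (simp add: f_def R_def)
    qed
  qed
  \<comment> \<open>The constant 1 serves as the upper function in property (C).\<close>
  have EV: "E f \<le> ereal (V ?A)"
    using C[unfolded property_C_def, rule_format, OF A fH H_const[of 1]] f_le
    by (auto simp: indicator_def)
  have ER: "E R \<le> ereal (K * c1 * m1 + K * c2 * m2)"
    unfolding R_def by (rule E_subadd_real)
      (use pos F1 F2 in \<open>auto simp: H_scale E_scale\<close>)
  \<comment> \<open>A difference cannot be split from below, so \<open>K * F0\<close> is written as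
    \<open>f + R\<close> and sub-additivity is applied to this sum.\<close>
  have EG: "ereal (K * m0) = E (\<lambda>\<omega>. f \<omega> + R \<omega>)"
    using E_scale[OF F0(1), of K] F0(3) pos by (simp add: f_def)
  \<comment> \<open>Together with \<open>ER\<close> this makes \<open>E R\<close> finite, which
    excludes the form \<open>\<infinity> - \<infinity>\<close>.\<close>
  have R_nonneg: "0 \<le> R \<omega>" if "\<omega> \<in> space M" for \<omega>
    using pos F1(2)[OF that] F2(2)[OF that] by (simp add: R_def)
  have "ereal 0 \<le> E R"
    using E_mono[OF RH H_const[of 0]] R_nonneg by (simp add: E_const)
  then obtain r where r: "E R = ereal r" "r \<le> K * c1 * m1 + K * c2 * m2"
    using ER by (cases "E R") auto
  have "ereal (K * m0) \<le> E f + ereal r"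
    using E_subadd[OF fH RH] EV by (auto simp: EG r(1))
  also have "\<dots> \<le> ereal (V ?A) + ereal r" using EV by (intro add_right_mono)
  finally have main: "K * m0 - (K * (c1 * m1) + K * (c2 * m2)) \<le> V ?A" using r by simp
  \<comment> \<open>The exponent gap and \<open>large\<close> make each subtracted part at most a
    quarter of the lower bound \<open>exp (lo * x\<^sup>2)\<close> for \<open>m0\<close>; half of it
    remains.\<close>
  have quarter: "exp y * m \<le> exp (lo * x\<^sup>2) / 4"
    if "m \<le> exp (up c * x\<^sup>2)" "y = d * x\<^sup>2" "d + up c + z\<^sup>2 * \<eta>\<^sup>2 / 8 \<le> lo" for m c d y
  proof -
    have "exp y * m \<le> exp y * exp (up c * x\<^sup>2)" using that by (intro mult_left_mono) auto
    also have "\<dots> = exp ((d + up c) * x\<^sup>2)" using that by (simp add: algebra_simps flip: exp_add)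
    also have "\<dots> \<le> exp ((lo - z\<^sup>2 * \<eta>\<^sup>2 / 8) * x\<^sup>2)"
      using that by (simp add: mult_right_mono)
    also have "\<dots> = exp (lo * x\<^sup>2) * exp (- (z\<^sup>2 * \<eta>\<^sup>2 / 8) * x\<^sup>2)"
      by (simp add: algebra_simps flip: exp_add)
    also have "\<dots> \<le> exp (lo * x\<^sup>2) * (1 / 4)" using large by (intro mult_left_mono) auto
    finally show ?thesis by simp
  qed
  have "c1 * m1 \<le> exp (lo * x\<^sup>2) / 4"
    unfolding c1_def by (rule quarter[OF F1(4) refl]) (use poly(1) in \<open>simp add: up_def\<close>)
  moreover have "c2 * m2 \<le> exp (lo * x\<^sup>2) / 4"
    unfolding c2_def by (rule quarter[OF F2(4) refl]) (use poly(2) in \<open>simp add: up_def\<close>)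
  ultimately have "exp (lo * x\<^sup>2) / 2 \<le> m0 - (c1 * m1 + c2 * m2)"
    using F0(4) by linarith
  then have "K * (exp (lo * x\<^sup>2) / 2) \<le> K * (m0 - (c1 * m1 + c2 * m2))"
    using pos by (intro mult_left_mono) auto
  also have "\<dots> \<le> V ?A" using main by (simp add: algebra_simps)
  finally have "K * exp (lo * x\<^sup>2) / 2 \<le> V ?A" by simp
  moreover have "- (z\<^sup>2 / 2 * (1 + 8 * \<eta>)) * x\<^sup>2 \<le> (lo - l * b) * x\<^sup>2"
    using poly(3) by (intro mult_right_mono) auto
  then have "exp (- (z\<^sup>2 / 2 * (1 + 8 * \<eta>)) * x\<^sup>2) \<le> K * exp (lo * x\<^sup>2)"
    by (simp add: K_def left_diff_distrib flip: exp_add)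
  ultimately show ?thesis by linarith
qed

end

section \<open>Choice of constants and passage to the limit\<close>

theorem lemma3p2:
  fixes \<gamma> :: real
  assumes "\<gamma> > 0"
  shows "\<exists>\<pi>::real. \<pi> > 0 \<and>
    (\<forall>(M :: 'a measure) (H :: ('a \<Rightarrow> real) set) (E :: ('a \<Rightarrow> real) \<Rightarrow> ereal) (V :: 'a set \<Rightarrow> real)
      (k :: nat \<Rightarrow> nat) (X :: nat \<Rightarrow> nat \<Rightarrow> 'a \<Rightarrow> real) (s :: nat \<Rightarrow> real) (x :: nat \<Rightarrow> real) (\<alpha> :: real).
      sublinear_expectation_space M H E \<longrightarrow>
      subadditive_capacity M V \<longrightarrow>
      property_C M H E V \<longrightarrow>
      (\<forall>n\<ge>1. \<forall>i\<in>{1..k n}. X n i \<in> H) \<longrightarrow>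
      (\<forall>n\<ge>1. independent_rvs H E (k n) (X n)) \<longrightarrow>
      (\<forall>n\<ge>1. s n \<ge> 0 \<and> ereal ((s n)\<^sup>2) = (\<Sum>i=1..k n. E (\<lambda>\<omega>. (X n i \<omega>)\<^sup>2))) \<longrightarrow>
      (\<forall>n\<ge>1. x n > 0) \<longrightarrow>
      filterlim x at_top sequentially \<longrightarrow>
      (\<lambda>n. x n / s n) \<longlonglongrightarrow> 0 \<longrightarrow>
      (\<lambda>n. (\<Sum>i=1..k n. \<bar>E (X n i)\<bar>) / ereal (s n * x n)) \<longlonglongrightarrow> 0 \<longrightarrow>
      (\<lambda>n. (\<Sum>i=1..k n. \<bar>conj_expectation E (X n i)\<bar>) / ereal (s n * x n)) \<longlonglongrightarrow> 0 \<longrightarrow>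
      \<alpha> > 0 \<longrightarrow>
      (\<forall>n\<ge>1. \<forall>i\<in>{1..k n}. \<forall>\<omega>\<in>space M. \<bar>X n i \<omega>\<bar> \<le> \<alpha> * (s n / x n)) \<longrightarrow>
      (\<forall>z::real. 0 < z * \<alpha> \<and> z * \<alpha> \<le> \<pi> \<longrightarrow>
        liminf (\<lambda>n. ereal (1 / (x n)\<^sup>2) *
            ln_ext (V {\<omega> \<in> space M. (\<Sum>i=1..k n. X n i \<omega>) \<ge> z * s n * x n}))
          \<ge> ereal (- (z\<^sup>2 / 2) * (1 + \<gamma>))))"
proof -
  \<comment> \<open>The rate in the tail bound costs \<open>8 * \<eta>\<close>, and absorbing its
    factor 1/2 costs one more \<open>\<eta>\<close>; hence the 9.\<close>
  define \<eta> where "\<eta> = min 1 (\<gamma> / 9)"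
  have \<eta>: "0 < \<eta>" "\<eta> \<le> 1" "9 * \<eta> \<le> \<gamma>" using assms by (auto simp: \<eta>_def)
  \<comment> \<open>As \<open>1 + 2 * \<eta> \<le> 3\<close>, the value
    \<open>\<eta>\<^sup>2 / 180\<close> yields the bound \<open>\<eta>\<^sup>2 / 60\<close> that the
    tail estimate asks for. It depends on \<open>\<gamma>\<close> alone.\<close>
  show ?thesis
  proof (intro exI[of _ "\<eta>\<^sup>2 / 180"] conjI allI impI)
    show "0 < \<eta>\<^sup>2 / 180" using \<eta> by simp
  next
    fix M :: "'a measure" and H :: "('a \<Rightarrow> real) set" and E :: "('a \<Rightarrow> real) \<Rightarrow> ereal"
      and V :: "'a set \<Rightarrow> real" and k :: "nat \<Rightarrow> nat" and X :: "nat \<Rightarrow> nat \<Rightarrow> 'a \<Rightarrow> real"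
      and s x :: "nat \<Rightarrow> real" and \<alpha> z :: real
    assume "sublinear_expectation_space M H E"
      and V: "subadditive_capacity M V" and C: "property_C M H E V"
      and X: "\<forall>n\<ge>1. \<forall>i\<in>{1..k n}. X n i \<in> H"
      and ind: "\<forall>n\<ge>1. independent_rvs H E (k n) (X n)"
      and s: "\<forall>n\<ge>1. s n \<ge> 0 \<and> ereal ((s n)\<^sup>2) = (\<Sum>i=1..k n. E (\<lambda>\<omega>. (X n i \<omega>)\<^sup>2))"
      and x: "\<forall>n\<ge>1. x n > 0" and x_top: "filterlim x at_top sequentially"
      and EX: "(\<lambda>n. (\<Sum>i=1..k n. \<bar>E (X n i)\<bar>) / ereal (s n * x n)) \<longlonglongrightarrow> 0"
      and CX: "(\<lambda>n. (\<Sum>i=1..k n. \<bar>conj_expectation E (X n i)\<bar>) / ereal (s n * x n)) \<longlonglongrightarrow> 0"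
      and \<alpha>: "\<alpha> > 0"
      and bnd: "\<forall>n\<ge>1. \<forall>i\<in>{1..k n}. \<forall>\<omega>\<in>space M. \<bar>X n i \<omega>\<bar> \<le> \<alpha> * (s n / x n)"
      and z: "0 < z * \<alpha> \<and> z * \<alpha> \<le> \<eta>\<^sup>2 / 180"
    interpret sublinear_expectation_space M H E by fact
    have z0: "0 < z" using z \<alpha> by (auto simp: zero_less_mult_iff)
    define \<theta> where "\<theta> = z * \<eta>\<^sup>2 / 56"
    have \<theta>: "0 < ereal \<theta>" using z0 \<eta> by (simp add: \<theta>_def)
    have ev_p: "\<forall>\<^sub>F n in sequentially. (\<Sum>i=1..k n. \<bar>E (X n i)\<bar>) / ereal (s n * x n) < ereal \<theta>"
      by (rule order_tendstoD(2)[OF EX \<theta>])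
    have ev_q: "\<forall>\<^sub>F n in sequentially.
        (\<Sum>i=1..k n. \<bar>conj_expectation E (X n i)\<bar>) / ereal (s n * x n) < ereal \<theta>"
      by (rule order_tendstoD(2)[OF CX \<theta>])
    have x2_top: "filterlim (\<lambda>n. (x n)\<^sup>2) at_top sequentially"
      using x_top by (intro filterlim_pow_at_top) auto
    \<comment> \<open>The first threshold gives the factor 1/4 in \<open>large\<close>; the second
      gives \<open>ln 2 \<le> z\<^sup>2 / 2 * \<eta> * (x n)\<^sup>2\<close>, which absorbs the
      factor 1/2.\<close>
    then have ev_x: "\<forall>\<^sub>F n in sequentially. (x n)\<^sup>2 \<ge> ln 4 / (z\<^sup>2 * \<eta>\<^sup>2 / 8)"
        "\<forall>\<^sub>F n in sequentially. (x n)\<^sup>2 \<ge> ln 2 / (z\<^sup>2 / 2 * \<eta>)"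
      by (simp_all add: filterlim_at_top)
    have "\<forall>\<^sub>F n in sequentially. ereal (- (z\<^sup>2 / 2) * (1 + \<gamma>)) \<le> ereal (1 / (x n)\<^sup>2) *
        ln_ext (V {\<omega> \<in> space M. (\<Sum>i=1..k n. X n i \<omega>) \<ge> z * s n * x n})"
      using ev_p ev_q ev_x eventually_ge_at_top[of 1]
    proof eventually_elim
      case (elim n)
      let ?A = "{\<omega> \<in> space M. (\<Sum>i=1..k n. X n i \<omega>) \<ge> z * s n * x n}"
      have xn: "0 < x n" using x elim by simp
      have bndn: "\<bar>X n i \<omega>\<bar> \<le> \<alpha> * (s n / x n)" if "i \<in> {1..k n}" "\<omega> \<in> space M" for i \<omega>
        using bnd elim that by simp
      have Xn: "X n i \<in> H" if "i \<in> {1..k n}" for i using X elim that by simp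
      show ?case
      proof (cases "s n = 0")
        text \<open>Not excluded by \<open>x n / s n \<longlonglongrightarrow> 0\<close>, because \<open>x n / 0 = 0\<close>.\<close>
        case True
        then have "X n i \<omega> = 0" if "i \<in> {1..k n}" "\<omega> \<in> space M" for i \<omega>
          using bndn[OF that] by simp
        then have "?A = space M" using True by auto
        then have "V ?A = 1" using V by (simp add: subadditive_capacity_def capacity_def)
        then show ?thesis using assms by (simp add: ln_ext_def mult_nonneg_nonneg)
      next
        case False
        have sn: "0 < s n" using False s elim by (metis less_eq_real_def)
        define B where "B = \<alpha> * (s n / x n)"
        have B: "0 \<le> B" using \<alpha> sn xn by (simp add: B_def)
        have "\<exists>r. E (X n i) = ereal r" if "i \<in> {1..k n}" for i
          by (rule E_bounded[OF Xn[OF that], of "- B" B]) (use bndn[OF that] in \<open>auto simp: B_def abs_le_iff minus_le_iff\<close>)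
        then obtain p where p: "\<And>i. i \<in> {1..k n} \<Longrightarrow> E (X n i) = ereal (p i)" by metis
        have "\<exists>r. E (\<lambda>\<omega>. - X n i \<omega>) = ereal r" if "i \<in> {1..k n}" for i
          by (rule E_bounded[OF H_uminus[OF Xn[OF that]], of "- B" B]) (use bndn[OF that] in \<open>auto simp: B_def abs_le_iff minus_le_iff\<close>)
        then obtain q where q: "\<And>i. i \<in> {1..k n} \<Longrightarrow> E (\<lambda>\<omega>. - X n i \<omega>) = ereal (q i)" by metis
        have "\<exists>r. E (\<lambda>\<omega>. (X n i \<omega>)\<^sup>2) = ereal r" if "i \<in> {1..k n}" for i
        proof (rule E_bounded[OF H_square[OF Xn[OF that]]])
          show "0 \<le> (X n i \<omega>)\<^sup>2" for \<omega> by simp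
          show "(X n i \<omega>)\<^sup>2 \<le> B\<^sup>2" if "\<omega> \<in> space M" for \<omega>
            using bndn[OF \<open>i \<in> {1..k n}\<close> that] unfolding B_def
            by (metis abs_ge_zero power2_abs power_mono)
        qed auto
        then obtain v where v: "\<And>i. i \<in> {1..k n} \<Longrightarrow> E (\<lambda>\<omega>. (X n i \<omega>)\<^sup>2) = ereal (v i)" by metis
        have s2: "(s n)\<^sup>2 = (\<Sum>i=1..k n. v i)"
          using s[rule_format, of n] elim v by simp
        have P: "(\<Sum>i=1..k n. \<bar>p i\<bar>) \<le> z * \<eta>\<^sup>2 / 56 * (s n * x n)"
          using elim(1) sn xn sum.cong[OF refl, of "{1..k n}" "\<lambda>i. \<bar>E (X n i)\<bar>" "\<lambda>i. ereal \<bar>p i\<bar>"] p by (simp add: \<theta>_def divide_less_eq)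
        \<comment> \<open>The conjugate expectation is minus the expectation of
          \<open>- X n i\<close>, so its absolute value is \<open>\<bar>q i\<bar>\<close>.\<close>
        have Q: "(\<Sum>i=1..k n. \<bar>q i\<bar>) \<le> z * \<eta>\<^sup>2 / 56 * (s n * x n)"
          using elim(2) sn xn sum.cong[OF refl, of "{1..k n}" "\<lambda>i. \<bar>conj_expectation E (X n i)\<bar>" "\<lambda>i. ereal \<bar>q i\<bar>"] q by (simp add: \<theta>_def divide_less_eq conj_expectation_def)
        have "z * (1 + 2 * \<eta>) * x n / s n * B = z * \<alpha> * (1 + 2 * \<eta>)"
          using sn xn by (simp add: B_def)
        also have "\<dots> \<le> \<eta>\<^sup>2 / 180 * 3" using z \<eta> by (intro mult_mono) auto
        finally have small: "z * (1 + 2 * \<eta>) * x n / s n * B \<le> \<eta>\<^sup>2 / 60" by simp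
        have "0 < z\<^sup>2 * \<eta>\<^sup>2 / 8" using z0 \<eta> by simp
        then have "ln 4 \<le> z\<^sup>2 * \<eta>\<^sup>2 / 8 * (x n)\<^sup>2"
          using elim(3) by (simp add: pos_divide_le_eq mult_ac)
        then have "exp (- (z\<^sup>2 * \<eta>\<^sup>2 / 8) * (x n)\<^sup>2) \<le> exp (- ln 4)" by simp
        then have large: "exp (- (z\<^sup>2 * \<eta>\<^sup>2 / 8) * (x n)\<^sup>2) \<le> 1 / 4" by (simp add: exp_minus)
        have lower: "exp (- (z\<^sup>2 / 2 * (1 + 8 * \<eta>)) * (x n)\<^sup>2) / 2 \<le> V ?A"
          by (rule capacity_tail_lower_bound[OF C Xn _ bndn[folded B_def] B p q v sn s2 xn z0 \<eta>(1,2) small P Q large])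
            (use ind elim in auto)
        have Vpos: "0 < V ?A" using lower by (rule less_le_trans[rotated]) simp
        have "0 < z\<^sup>2 / 2 * \<eta>" using z0 \<eta> by simp
        then have l2: "ln 2 \<le> z\<^sup>2 / 2 * \<eta> * (x n)\<^sup>2"
          using elim(4) by (simp add: pos_divide_le_eq mult_ac)
        have "z\<^sup>2 / 2 * (x n)\<^sup>2 * (9 * \<eta>) \<le> z\<^sup>2 / 2 * (x n)\<^sup>2 * \<gamma>"
          using \<eta> by (intro mult_left_mono) auto
        with l2 have "- (z\<^sup>2 / 2) * (1 + \<gamma>) * (x n)\<^sup>2 \<le> - (z\<^sup>2 / 2 * (1 + 8 * \<eta>)) * (x n)\<^sup>2 - ln 2"
          by (simp add: field_simps)
        also have "\<dots> = ln (exp (- (z\<^sup>2 / 2 * (1 + 8 * \<eta>)) * (x n)\<^sup>2) / 2)"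
          by (simp add: ln_div)
        also have "\<dots> \<le> ln (V ?A)" using lower by (intro ln_mono) auto
        finally have "- (z\<^sup>2 / 2) * (1 + \<gamma>) \<le> 1 / (x n)\<^sup>2 * ln (V ?A)"
          using xn by (simp add: pos_le_divide_eq)
        then show ?thesis using Vpos by (simp add: ln_ext_def)
      qed
    qed
    then show "liminf (\<lambda>n. ereal (1 / (x n)\<^sup>2) *
        ln_ext (V {\<omega> \<in> space M. (\<Sum>i=1..k n. X n i \<omega>) \<ge> z * s n * x n}))
        \<ge> ereal (- (z\<^sup>2 / 2) * (1 + \<gamma>))"
      by (rule Liminf_bounded)
  qed
qed

end
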